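(* Let $S\subseteq\mathbb{H}$ be open and let $f:S\to\mathbb{H}$ be continuous, such that its right HR derivatives up to order three exist and are continuous in $S$. If $q_0,q_0+\lambda\in S$ are such that the segment joining them is also in $S$, then, as $\lambda\to0$, $$f(q_0+\lambda)-f(q_0)=\sum_{\mu}\lambda^{\mu}\frac{\partial_r f(q_0)}{\partial q^{\mu}}+\frac12\sum_{\mu,\nu}\lambda^{\mu}\lambda^{\nu}\frac{\partial_r^2 f(q_0)}{\partial q^{\nu}\partial q^{\mu}}+O(|\lambda|^3)$$ $$=\sum_{\mu}\lambda^{\mu*}\frac{\partial_r f(q_0)}{\partial q^{\mu*}}+\frac12\sum_{\mu,\nu}\lambda^{\mu*}\lambda^{\nu*}\frac{\partial_r^2 f(q_0)}{\partial q^{\nu*}\partial q^{\mu*}}+O(|\lambda|^3),$$ where the sums run over $\mu,\nu\in\{1,i,j,k\}$.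
   Context: $\mathbb{H}$ denotes the real quaternions $q=q_a+iq_b+jq_c+kq_d$ with $q_a,q_b,q_c,q_d\in\mathbb{R}$ and $i^2=j^2=k^2=ijk=-1$. The conjugate is $q^*=q_a-iq_b-jq_c-kq_d$, and $|q|=\sqrt{qq^*}$. For $\mu\in\{1,i,j,k\}$ and $p\in\mathbb{H}$, $p^{\mu}:=\mu p\mu^{-1}$ and $p^{\mu*}:=(p^{\mu})^*$. An $\mathbb{H}$-valued function $f$ is regarded as a function of the four real variables $q_a,q_b,q_c,q_d$, with ($\mathbb{H}$-valued, componentwise) partial derivatives $\frac{\partial f}{\partial q_a},\dots,\frac{\partial f}{\partial q_d}$. The right HR derivatives of $f$ are, for $\mu\in\{1,i,j,k\}$, $$\frac{\partial_r f}{\partial q^{\mu}}=\frac14\left(\frac{\partial f}{\partial q_a}-i^{\mu}\frac{\partial f}{\partial q_b}-j^{\mu}\frac{\partial f}{\partial q_c}-k^{\mu}\frac{\partial f}{\partial q_d}\right),\qquad \frac{\partial_r f}{\partial q^{\mu*}}=\frac14\left(\frac{\partial f}{\partial q_a}+i^{\mu}\frac{\partial f}{\partial q_b}+j^{\mu}\frac{\partial f}{\partial q_c}+k^{\mu}\frac{\partial f}{\partial q_d}\right).$$ Higher-order right HR derivatives are iterated ones: $\frac{\partial_r^2 f}{\partial q^{\nu}\partial q^{\mu}}=\frac{\partial_r}{\partial q^{\nu}}\left(\frac{\partial_r f}{\partial q^{\mu}}\right)$, $\frac{\partial_r^2 f}{\partial q^{\nu*}\partial q^{\mu*}}=\frac{\partial_r}{\partial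 q^{\nu*}}\left(\frac{\partial_r f}{\partial q^{\mu*}}\right)$, and similarly for mixed choices and for third order. *)

theory Defs
  imports "HOL-Analysis.Analysis"
begin

section \<open>The real quaternions\<close>

datatype quat = Quat (qa: real) (qb: real) (qc: real) (qd: real)

lemma quat_eq_iff: "p = q \<longleftrightarrow> qa p = qa q \<and> qb p = qb q \<and> qc p = qc q \<and> qd p = qd q"
  by (cases p; cases q) simp

instantiation quat :: real_vector
begin

definition zero_quat_def: "0 = Quat 0 0 0 0"
definition plus_quat_def: "p + q = Quat (qa p + qa q) (qb p + qb q) (qc p + qc q) (qd p + qd q)"
definition uminus_quat_def: "- p = Quat (- qa p) (- qb p) (- qc p) (- qd p)"
definition minus_quat_def: "p - q = Quat (qa p - qa q) (qb p - qb q) (qc p - qc q) (qd p - qd q)"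
definition scaleR_quat_def: "r *\<^sub>R q = Quat (r * qa q) (r * qb q) (r * qc q) (r * qd q)"

instance
  by standard
    (simp_all add: quat_eq_iff zero_quat_def plus_quat_def uminus_quat_def minus_quat_def
      scaleR_quat_def algebra_simps)

end

lemma quat_sel_simps [simp]:
  "qa 0 = 0" "qb 0 = 0" "qc 0 = 0" "qd 0 = 0"
  "qa (p + q) = qa p + qa q" "qb (p + q) = qb p + qb q"
  "qc (p + q) = qc p + qc q" "qd (p + q) = qd p + qd q"
  "qa (- p) = - qa p" "qb (- p) = - qb p" "qc (- p) = - qc p" "qd (- p) = - qd p"
  "qa (p - q) = qa p - qa q" "qb (p - q) = qb p - qb q"
  "qc (p - q) = qc p - qc q" "qd (p - q) = qd p - qd q"
  "qa (r *\<^sub>R p) = r * qa p" "qb (r *\<^sub>R p) = r * qb p"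
  "qc (r *\<^sub>R p) = r * qc p" "qd (r *\<^sub>R p) = r * qd p"
  by (simp_all add: zero_quat_def plus_quat_def uminus_quat_def minus_quat_def scaleR_quat_def)

definition qcnj :: "quat \<Rightarrow> quat"
  where "qcnj q = Quat (qa q) (- qb q) (- qc q) (- qd q)"

lemma qcnj_sel [simp]:
  "qa (qcnj q) = qa q" "qb (qcnj q) = - qb q" "qc (qcnj q) = - qc q" "qd (qcnj q) = - qd q"
  by (simp_all add: qcnj_def)

instantiation quat :: real_inner
begin

definition inner_quat_def: "inner p q = qa p * qa q + qb p * qb q + qc p * qc q + qd p * qd q"
definition norm_quat_def: "norm q = sqrt ((qa q)\<^sup>2 + (qb q)\<^sup>2 + (qc q)\<^sup>2 + (qd q)\<^sup>2)"
definition sgn_quat_def: "sgn (q::quat) = q /\<^sub>R norm q"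
definition dist_quat_def: "dist (p::quat) q = norm (p - q)"
definition uniformity_quat_def [code del]:
  "(uniformity :: (quat \<times> quat) filter) = (INF e\<in>{0 <..}. principal {(x, y). dist x y < e})"
definition open_quat_def [code del]:
  "open (U :: quat set) \<longleftrightarrow> (\<forall>x\<in>U. eventually (\<lambda>(x', y). x' = x \<longrightarrow> y \<in> U) uniformity)"

instance
proof
  fix p q r :: quat and a :: real
  show "dist p q = norm (p - q)" by (rule dist_quat_def)
  show "sgn p = p /\<^sub>R norm p" by (rule sgn_quat_def)
  show "uniformity = (INF e\<in>{0<..}. principal {(x::quat, y). dist x y < e})"
    by (rule uniformity_quat_def)
  show "open U \<longleftrightarrow> (\<forall>x\<in>U. \<forall>\<^sub>F (x', y) in uniformity. x' = x \<longrightarrow> y \<in> U)" for U :: "quat set"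
    by (rule open_quat_def)
  show "inner p q = inner q p" by (simp add: inner_quat_def mult.commute)
  show "inner (p + q) r = inner p r + inner q r" by (simp add: inner_quat_def algebra_simps)
  show "inner (a *\<^sub>R p) q = a * inner p q" by (simp add: inner_quat_def algebra_simps)
  show "0 \<le> inner p p" by (simp add: inner_quat_def)
  show "inner p p = 0 \<longleftrightarrow> p = 0"
  proof
    assume "inner p p = 0"
    moreover have "0 \<le> qa p * qa p" "0 \<le> qb p * qb p" "0 \<le> qc p * qc p" "0 \<le> qd p * qd p"
      by simp_all
    ultimately have "qa p * qa p = 0" "qb p * qb p = 0" "qc p * qc p = 0" "qd p * qd p = 0"
      unfolding inner_quat_def by linarith+
    then show "p = 0" by (simp add: quat_eq_iff)
  qed (simp add: inner_quat_def)
  show "norm p = sqrt (inner p p)" by (simp add: norm_quat_def inner_quat_def power2_eq_square)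
qed

end

lemma norm_quat_sq: "(norm q)\<^sup>2 = (qa q)\<^sup>2 + (qb q)\<^sup>2 + (qc q)\<^sup>2 + (qd q)\<^sup>2"
  by (simp add: norm_quat_def)

instantiation quat :: real_algebra_1
begin

definition one_quat_def: "1 = Quat 1 0 0 0"
text \<open>The bilinear extension of \<open>i\<^sup>2 = j\<^sup>2 = k\<^sup>2 = ijk = -1\<close>.\<close>
definition times_quat_def:
  "p * q = Quat (qa p * qa q - qb p * qb q - qc p * qc q - qd p * qd q)
                (qa p * qb q + qb p * qa q + qc p * qd q - qd p * qc q)
                (qa p * qc q - qb p * qd q + qc p * qa q + qd p * qb q)
                (qa p * qd q + qb p * qc q - qc p * qb q + qd p * qa q)"

instance
  by standard (simp_all add: quat_eq_iff one_quat_def times_quat_def algebra_simps)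

end

lemma quat_mult_sel [simp]:
  "qa (p * q) = qa p * qa q - qb p * qb q - qc p * qc q - qd p * qd q"
  "qb (p * q) = qa p * qb q + qb p * qa q + qc p * qd q - qd p * qc q"
  "qc (p * q) = qa p * qc q - qb p * qd q + qc p * qa q + qd p * qb q"
  "qd (p * q) = qa p * qd q + qb p * qc q - qc p * qb q + qd p * qa q"
  "qa 1 = 1" "qb 1 = 0" "qc 1 = 0" "qd 1 = 0"
  by (simp_all add: times_quat_def one_quat_def)

lemma quat_mult_qcnj: "q * qcnj q = of_real ((norm q)\<^sup>2)" "qcnj q * q = of_real ((norm q)\<^sup>2)"
  by (simp_all add: quat_eq_iff norm_quat_sq of_real_def) (simp_all add: power2_eq_square)

instantiation quat :: real_normed_div_algebra
begin

definition inverse_quat_def: "inverse q = qcnj q /\<^sub>R (norm q)\<^sup>2"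
definition divide_quat_def: "p div (q::quat) = p * inverse q"

instance
proof
  fix p q :: quat
  show "norm (p * q) = norm p * norm q"
  proof (rule power2_eq_imp_eq)
    show "(norm (p * q))\<^sup>2 = (norm p * norm q)\<^sup>2"
      unfolding power_mult_distrib norm_quat_sq quat_mult_sel
      by (simp add: power2_eq_square algebra_simps)
  qed simp_all
  show "p \<noteq> 0 \<Longrightarrow> inverse p * p = 1" "p \<noteq> 0 \<Longrightarrow> p * inverse p = 1"
    by (simp_all add: inverse_quat_def quat_mult_qcnj of_real_def)
  show "p div q = p * inverse q" by (rule divide_quat_def)
  show "inverse (0::quat) = 0" by (simp add: inverse_quat_def quat_eq_iff)
qed

end

definition quat_i :: quat ("\<i>\<^sub>q") where "\<i>\<^sub>q = Quat 0 1 0 0"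
definition quat_j :: quat ("\<j>\<^sub>q") where "\<j>\<^sub>q = Quat 0 0 1 0"
definition quat_k :: quat ("\<k>\<^sub>q") where "\<k>\<^sub>q = Quat 0 0 0 1"

lemma quat_unit_relations:
  "\<i>\<^sub>q * \<i>\<^sub>q = -1" "\<j>\<^sub>q * \<j>\<^sub>q = -1" "\<k>\<^sub>q * \<k>\<^sub>q = -1" "\<i>\<^sub>q * \<j>\<^sub>q * \<k>\<^sub>q = -1"
  by (simp_all add: quat_eq_iff quat_i_def quat_j_def quat_k_def)

lemma quat_decomp:
  "q = of_real (qa q) + \<i>\<^sub>q * of_real (qb q) + \<j>\<^sub>q * of_real (qc q) + \<k>\<^sub>q * of_real (qd q)"
  by (simp add: quat_eq_iff quat_i_def quat_j_def quat_k_def of_real_def)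

instantiation quat :: euclidean_space
begin

definition Basis_quat_def: "Basis = {1, \<i>\<^sub>q, \<j>\<^sub>q, \<k>\<^sub>q}"

instance
proof
  fix u v :: quat
  show "(Basis :: quat set) \<noteq> {}" "finite (Basis :: quat set)" by (simp_all add: Basis_quat_def)
  show "u \<in> Basis \<Longrightarrow> v \<in> Basis \<Longrightarrow> inner u v = (if u = v then 1 else 0)"
    by (auto simp: Basis_quat_def inner_quat_def quat_eq_iff quat_i_def quat_j_def quat_k_def)
  show "(\<forall>b\<in>Basis. inner u b = 0) \<longleftrightarrow> u = 0"
    by (simp add: Basis_quat_def inner_quat_def quat_eq_iff[of u] quat_i_def quat_j_def quat_k_def)
qed

end


section \<open>Rotations and right HR derivatives\<close>

definition quat_units :: "quat set"
  where "quat_units = {1, \<i>\<^sub>q, \<j>\<^sub>q, \<k>\<^sub>q}"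

lemma card_quat_units: "card quat_units = 4"
  by (simp add: quat_units_def quat_eq_iff quat_i_def quat_j_def quat_k_def)

definition qrot :: "quat \<Rightarrow> quat \<Rightarrow> quat"
  where "qrot \<mu> p = \<mu> * p * inverse \<mu>"

text \<open>
  The partial derivative in the real coordinate belonging to the basis quaternion \<open>e\<close>; for
  \<open>e = 1, \<i>\<^sub>q, \<j>\<^sub>q, \<k>\<^sub>q\<close> these are the partial derivatives with respect to
  \<open>q\<^sub>a, q\<^sub>b, q\<^sub>c, q\<^sub>d\<close>.  On the open set where a function is of interest they, and all the operators
  below, only depend on the values of the function in that set.
\<close>
definition qpartial :: "quat \<Rightarrow> (quat \<Rightarrow> quat) \<Rightarrow> quat \<Rightarrow> quat"
  where "qpartial e f q = vector_derivative (\<lambda>t. f (q + t *\<^sub>R e)) (at 0)"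

definition qpartials_exist_at :: "(quat \<Rightarrow> quat) \<Rightarrow> quat \<Rightarrow> bool"
  where "qpartials_exist_at f q \<longleftrightarrow> (\<forall>e\<in>{1, \<i>\<^sub>q, \<j>\<^sub>q, \<k>\<^sub>q}. (\<lambda>t::real. f (q + t *\<^sub>R e)) differentiable (at 0))"

definition hr_deriv :: "quat \<Rightarrow> (quat \<Rightarrow> quat) \<Rightarrow> quat \<Rightarrow> quat"
  where "hr_deriv \<mu> f q = (1/4) *\<^sub>R
    (qpartial 1 f q - qrot \<mu> \<i>\<^sub>q * qpartial \<i>\<^sub>q f q
      - qrot \<mu> \<j>\<^sub>q * qpartial \<j>\<^sub>q f q - qrot \<mu> \<k>\<^sub>q * qpartial \<k>\<^sub>q f q)"

definition hr_conj_deriv :: "quat \<Rightarrow> (quat \<Rightarrow> quat) \<Rightarrow> quat \<Rightarrow> quat"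
  where "hr_conj_deriv \<mu> f q = (1/4) *\<^sub>R
    (qpartial 1 f q + qrot \<mu> \<i>\<^sub>q * qpartial \<i>\<^sub>q f q
      + qrot \<mu> \<j>\<^sub>q * qpartial \<j>\<^sub>q f q + qrot \<mu> \<k>\<^sub>q * qpartial \<k>\<^sub>q f q)"

text \<open>
  All iterated right HR derivatives of orders \<open>1, \<dots>, n\<close>, for every choice of \<open>q\<^sup>\<mu>\<close> or
  \<open>q\<^sup>\<mu>\<^sup>*\<close> in each step, exist and are continuous in \<open>S\<close>.  Existence of the right HR derivatives of
  a function means existence of the four partial derivatives that occur in their definition.
\<close>
fun hr_derivs_continuous_on :: "nat \<Rightarrow> quat set \<Rightarrow> (quat \<Rightarrow> quat) \<Rightarrow> bool" where
  "hr_derivs_continuous_on 0 S f \<longleftrightarrow> True"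
| "hr_derivs_continuous_on (Suc n) S f \<longleftrightarrow>
     (\<forall>q\<in>S. qpartials_exist_at f q) \<and>
     (\<forall>\<mu>\<in>quat_units.
        continuous_on S (hr_deriv \<mu> f) \<and> hr_derivs_continuous_on n S (hr_deriv \<mu> f) \<and>
        continuous_on S (hr_conj_deriv \<mu> f) \<and> hr_derivs_continuous_on n S (hr_conj_deriv \<mu> f))"

end

theory Submission
  imports Defs
begin

text \<open>
  Every right HR derivative mixes the four partial derivatives, but weighting them by the rotated
  increments \<open>\<lambda>\<^sup>\<mu>\<close> and summing over \<open>\<mu>\<close> undoes the mixing.  Since \<open>p \<mapsto> p\<^sup>\<mu>\<close> is multiplicative and
  the four rotations of \<open>p\<close> add up to \<open>4 Re p\<close>, the coefficient of \<open>\<partial>f/\<partial>q\<^sub>b\<close> in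
  \<open>\<Sum>\<^sub>\<mu> \<lambda>\<^sup>\<mu> \<partial>f/\<partial>q\<^sup>\<mu>\<close> is \<open>- Re (\<lambda> i) = \<lambda>\<^sub>b\<close>, and likewise for the other coordinates.  So the sum
  is the directional derivative of \<open>f\<close> along \<open>\<lambda>\<close> (\<open>sum_qrot_hr_deriv\<close>), and the same holds for the
  conjugated version (\<open>sum_qrot_hr_conj_deriv\<close>).

  Taking a basis quaternion for \<open>\<lambda>\<close> expresses the partial derivatives through the HR derivatives.
  Hence continuity of the latter gives continuity of the former, thus Frechet differentiability, and
  \<open>h \<mapsto> \<Sum>\<^sub>\<mu> h\<^sup>\<mu> \<partial>f(x)/\<partial>q\<^sup>\<mu>\<close> is the derivative of \<open>f\<close> at \<open>x\<close>.
  This applies again to the HR derivatives of order one and two.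

  Along the segment, \<open>g(t) = f(q\<^sub>0 + t \<lambda>)\<close> therefore has derivative
  \<open>\<Sum>\<^sub>\<mu> \<lambda>\<^sup>\<mu> (\<partial>f/\<partial>q\<^sup>\<mu>)(q\<^sub>0 + t \<lambda>)\<close>.  The left factors do not depend on \<open>t\<close>, so differentiating
  again just inserts a further factor \<open>\<lambda>\<^sup>\<nu>\<close> to their right and a further HR derivative: the
  Taylor polynomial of \<open>g\<close> at \<open>t = 0\<close>, evaluated at \<open>t = 1\<close>, already is the claimed expansion.
  As \<open>|\<lambda>\<^sup>\<mu>| = |\<lambda>|\<close> and the third HR
  derivatives are bounded near \<open>q\<^sub>0\<close>, the integral remainder is \<open>O(|\<lambda>|\<^sup>3)\<close>
  (\<open>taylor2_derivative_operators\<close>).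
\<close>

section \<open>Continuous partial derivatives\<close>

text \<open>
  The classical criterion, by walking from \<open>q\<close> to \<open>q + h\<close> parallel to one axis after the other: on
  each leg the mean value inequality compares the increment with the partial derivative at \<open>q\<close>
  itself, up to an error controlled by continuity.
\<close>
lemma has_derivative_continuous_partials:
  fixes f :: "'a::euclidean_space \<Rightarrow> 'b::real_normed_vector" and f' :: "'a \<Rightarrow> 'a \<Rightarrow> 'b"
  assumes "open S" "q \<in> S"
    and partial: "\<And>x b. x \<in> S \<Longrightarrow> b \<in> Basis \<Longrightarrow>
      ((\<lambda>t. f (x + t *\<^sub>R b)) has_vector_derivative f' b x) (at 0)"
    and cont: "\<And>b. b \<in> Basis \<Longrightarrow> isCont (f' b) q"
  shows "(f has_derivative (\<lambda>h. \<Sum>b\<in>Basis. (h \<bullet> b) *\<^sub>R f' b q)) (at q)"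
  unfolding has_derivative_at_alt
proof (intro conjI allI impI)
  show "bounded_linear (\<lambda>h. \<Sum>b\<in>Basis. (h \<bullet> b) *\<^sub>R f' b q)"
    by (intro bounded_linear_intros)
next
  fix e :: real
  assume "0 < e"
  \<comment> \<open>The leg along \<open>b\<close> contributes an error of at most \<open>\<eta> * \<bar>h \<bullet> b\<bar> \<le> \<eta> * norm h\<close>.\<close>
  define \<eta> where "\<eta> = e / DIM('a)"
  have \<eta>: "0 < \<eta>" using \<open>0 < e\<close> by (simp add: \<eta>_def)
  have "\<forall>\<^sub>F x in nhds q. \<forall>b\<in>Basis. dist (f' b x) (f' b q) < \<eta>"
    using cont \<eta> by (simp add: eventually_ball_finite_distrib continuous_at tendsto_at_iff_tendsto_nhds tendstoD)
  moreover have "\<forall>\<^sub>F x in nhds q. x \<in> S"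
    using assms by (simp add: eventually_nhds_in_open)
  ultimately have "\<forall>\<^sub>F x in nhds q. x \<in> S \<and> (\<forall>b\<in>Basis. dist (f' b x) (f' b q) < \<eta>)"
    by eventually_elim auto
  then obtain r where "0 < r"
    and r: "\<And>x. dist x q < r \<Longrightarrow> x \<in> S \<and> (\<forall>b\<in>Basis. dist (f' b x) (f' b q) < \<eta>)"
    unfolding eventually_nhds_metric by blast
  have step: "norm (f (x + s *\<^sub>R b) - f x - s *\<^sub>R f' b q) \<le> \<bar>s\<bar> * \<eta>"
    if b: "b \<in> Basis" and x: "x \<in> ball q r" and y: "x + s *\<^sub>R b \<in> ball q r" for x s b
  proof -
    let ?I = "closed_segment 0 s"
    have seg: "x + t *\<^sub>R b \<in> ball q r" if t: "t \<in> ?I" for t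
    proof -
      obtain u where "0 \<le> u" "u \<le> 1" "t = u * s" using t by (auto simp: in_segment)
      then have "x + t *\<^sub>R b = (1 - u) *\<^sub>R x + u *\<^sub>R (x + s *\<^sub>R b)"
        by (simp add: algebra_simps)
      with convexD[OF convex_ball x y, of "1 - u" u] \<open>0 \<le> u\<close> \<open>u \<le> 1\<close> show ?thesis by simp
    qed
    have close: "norm (f' b y - f' b q) \<le> \<eta>" if "y \<in> ball q r" for y
      using r[of y] that b by (auto simp: dist_commute dist_norm norm_minus_commute intro: less_imp_le)
    have der: "((\<lambda>t. f (x + t *\<^sub>R b)) has_vector_derivative f' b (x + t *\<^sub>R b)) (at t within ?I)"
      if "t \<in> ?I" for t
    proof -
      have "x + t *\<^sub>R b \<in> S" using seg[OF that] r by (auto simp: dist_commute)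
      from partial[OF this b]
      have "((\<lambda>u. f (x + t *\<^sub>R b + u *\<^sub>R b)) has_vector_derivative f' b (x + t *\<^sub>R b)) (at (- t + t))"
        by simp
      then have "((\<lambda>u. f (x + t *\<^sub>R b + u *\<^sub>R b)) \<circ> (\<lambda>u. - t + u)
          has_vector_derivative 1 *\<^sub>R f' b (x + t *\<^sub>R b)) (at t)"
        by (intro vector_diff_chain_at) (auto intro!: derivative_eq_intros)
      then show ?thesis
        by (simp add: o_def algebra_simps has_vector_derivative_at_within)
    qed
    \<comment> \<open>Subtracting the linear term makes the derivative on the leg at most \<open>\<eta>\<close> in norm.\<close>
    have "((\<lambda>t. f (x + t *\<^sub>R b) - t *\<^sub>R f' b q) has_derivative
        (\<lambda>v. v *\<^sub>R (f' b (x + t *\<^sub>R b) - f' b q))) (at t within ?I)" if "t \<in> ?I" for t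
      using der[OF that] unfolding has_vector_derivative_def
      by (auto intro!: derivative_eq_intros simp: algebra_simps)
    moreover have "onorm (\<lambda>v. v *\<^sub>R (f' b (x + t *\<^sub>R b) - f' b q)) \<le> \<eta>" if "t \<in> ?I" for t
      using close[OF seg[OF that]] by (intro onorm_le) (simp add: mult.commute[of \<eta>] mult_left_mono)
    ultimately have "norm ((f (x + s *\<^sub>R b) - s *\<^sub>R f' b q) - (f (x + 0 *\<^sub>R b) - 0 *\<^sub>R f' b q))
        \<le> \<eta> * norm (s - 0)"
      by (intro differentiable_bound[of ?I]) auto
    then show ?thesis by (simp add: algebra_simps)
  qed
  have walk: "norm (f (q + (\<Sum>b\<in>D. (h \<bullet> b) *\<^sub>R b)) - f q - (\<Sum>b\<in>D. (h \<bullet> b) *\<^sub>R f' b q))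
      \<le> (\<Sum>b\<in>D. \<bar>h \<bullet> b\<bar>) * \<eta>"
    if "D \<subseteq> Basis" and h: "(\<Sum>b\<in>Basis. \<bar>h \<bullet> b\<bar>) < r" for D h
    using finite_subset[OF that(1) finite_Basis] that(1)
  proof (induction D)
    case (insert c D)
    \<comment> \<open>The \<open>l\<^sup>1\<close> norm of \<open>h\<close> dominates all partial sums, so no corner of the path leaves the ball.\<close>
    have ball: "q + (\<Sum>b\<in>E. (h \<bullet> b) *\<^sub>R b) \<in> ball q r" if "E \<subseteq> Basis" for E
    proof -
      have "norm (\<Sum>b\<in>E. (h \<bullet> b) *\<^sub>R b) \<le> (\<Sum>b\<in>E. \<bar>h \<bullet> b\<bar>)"
        using that by (intro sum_norm_le) auto
      also have "\<dots> \<le> (\<Sum>b\<in>Basis. \<bar>h \<bullet> b\<bar>)"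
        using that by (intro sum_mono2) auto
      finally show ?thesis using h by (simp add: dist_norm)
    qed
    let ?x = "q + (\<Sum>b\<in>D. (h \<bullet> b) *\<^sub>R b)"
    have "norm (f (?x + (h \<bullet> c) *\<^sub>R c) - f ?x - (h \<bullet> c) *\<^sub>R f' c q) \<le> \<bar>h \<bullet> c\<bar> * \<eta>"
      using ball[of D] ball[of "insert c D"] insert by (intro step) (auto simp: algebra_simps)
    moreover have "norm (f ?x - f q - (\<Sum>b\<in>D. (h \<bullet> b) *\<^sub>R f' b q)) \<le> (\<Sum>b\<in>D. \<bar>h \<bullet> b\<bar>) * \<eta>"
      using insert by auto
    ultimately have "norm ((f (?x + (h \<bullet> c) *\<^sub>R c) - f ?x - (h \<bullet> c) *\<^sub>R f' c q)
        + (f ?x - f q - (\<Sum>b\<in>D. (h \<bullet> b) *\<^sub>R f' b q)))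
        \<le> \<bar>h \<bullet> c\<bar> * \<eta> + (\<Sum>b\<in>D. \<bar>h \<bullet> b\<bar>) * \<eta>"
      by (rule norm_triangle_mono)
    with insert(1,2) show ?case by (simp add: algebra_simps)
  qed simp
  show "\<exists>d>0. \<forall>y. norm (y - q) < d \<longrightarrow>
      norm (f y - f q - (\<Sum>b\<in>Basis. ((y - q) \<bullet> b) *\<^sub>R f' b q)) \<le> e * norm (y - q)"
  proof (intro exI[of _ "r / DIM('a)"] conjI allI impI)
    show "0 < r / DIM('a)" using \<open>0 < r\<close> by simp
  next
    fix y
    assume y: "norm (y - q) < r / DIM('a)"
    have l1: "(\<Sum>b\<in>Basis. \<bar>(y - q) \<bullet> b\<bar>) \<le> DIM('a) * norm (y - q)"
      by (intro sum_bounded_above Basis_le_norm)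
    also have "\<dots> < r" using y by (simp add: field_simps)
    finally have "norm (f (q + (\<Sum>b\<in>Basis. ((y - q) \<bullet> b) *\<^sub>R b)) - f q
        - (\<Sum>b\<in>Basis. ((y - q) \<bullet> b) *\<^sub>R f' b q)) \<le> (\<Sum>b\<in>Basis. \<bar>(y - q) \<bullet> b\<bar>) * \<eta>"
      by (intro walk) auto
    also have "\<dots> \<le> (DIM('a) * norm (y - q)) * \<eta>"
      using l1 \<eta> by (intro mult_right_mono) auto
    finally show "norm (f y - f q - (\<Sum>b\<in>Basis. ((y - q) \<bullet> b) *\<^sub>R f' b q)) \<le> e * norm (y - q)"
      by (simp add: euclidean_representation \<eta>_def mult.commute)
  qed
qed

section \<open>Taylor expansion by iterated derivative operators\<close>

text \<open>
  An abstraction that covers the plain and the conjugated expansion at once.  The family \<open>D \<mu>\<close> is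
  any system of operators which, weighted from the left by coefficients \<open>a \<mu> h\<close>, reproduces the
  derivative along \<open>h\<close>.  Because the coefficients do not depend on the point, differentiating
  \<open>t \<mapsto> f (q + t *\<^sub>R h)\<close> repeatedly only iterates the operators, in the same order as the
  coefficients are multiplied; the Taylor formula with integral remainder does the rest.
\<close>
lemma taylor2_derivative_operators:
  fixes f :: "'a::real_normed_vector \<Rightarrow> 'b::{real_normed_algebra, banach}"
    and a :: "'i \<Rightarrow> 'a \<Rightarrow> 'b" and D :: "'i \<Rightarrow> ('a \<Rightarrow> 'b) \<Rightarrow> 'a \<Rightarrow> 'b"
  assumes "open S" "q \<in> S" "finite I"
    and a: "\<And>\<mu> h. \<mu> \<in> I \<Longrightarrow> norm (a \<mu> h) \<le> norm h"
    and der1: "\<And>x. x \<in> S \<Longrightarrow> (f has_derivative (\<lambda>h. \<Sum>\<mu>\<in>I. a \<mu> h * D \<mu> f x)) (at x)"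
    and der2: "\<And>\<mu> x. \<mu> \<in> I \<Longrightarrow> x \<in> S \<Longrightarrow>
      (D \<mu> f has_derivative (\<lambda>h. \<Sum>\<nu>\<in>I. a \<nu> h * D \<nu> (D \<mu> f) x)) (at x)"
    and der3: "\<And>\<mu> \<nu> x. \<mu> \<in> I \<Longrightarrow> \<nu> \<in> I \<Longrightarrow> x \<in> S \<Longrightarrow>
      (D \<nu> (D \<mu> f) has_derivative (\<lambda>h. \<Sum>\<kappa>\<in>I. a \<kappa> h * D \<kappa> (D \<nu> (D \<mu> f)) x)) (at x)"
    and cont: "\<And>\<mu> \<nu> \<kappa>. \<mu> \<in> I \<Longrightarrow> \<nu> \<in> I \<Longrightarrow> \<kappa> \<in> I \<Longrightarrow> isCont (D \<kappa> (D \<nu> (D \<mu> f))) q"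
  shows "(\<lambda>h. norm (f (q + h) - f q
        - ((\<Sum>\<mu>\<in>I. a \<mu> h * D \<mu> f q)
           + (1/2) *\<^sub>R (\<Sum>\<mu>\<in>I. \<Sum>\<nu>\<in>I. a \<mu> h * a \<nu> h * D \<nu> (D \<mu> f) q))))
      \<in> O[at 0](\<lambda>h. norm h ^ 3)"
proof -
  define B where "B \<mu> \<nu> \<kappa> = norm (D \<kappa> (D \<nu> (D \<mu> f)) q) + 1" for \<mu> \<nu> \<kappa>
  define K where "K = (\<Sum>\<mu>\<in>I. \<Sum>\<nu>\<in>I. \<Sum>\<kappa>\<in>I. B \<mu> \<nu> \<kappa>)"
  have "\<forall>\<^sub>F x in nhds q. norm (D \<kappa> (D \<nu> (D \<mu> f)) x) < B \<mu> \<nu> \<kappa>"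
    if "\<mu> \<in> I" "\<nu> \<in> I" "\<kappa> \<in> I" for \<mu> \<nu> \<kappa>
    using cont[OF that] unfolding continuous_at B_def
    by (intro order_tendstoD(2)[of _ "norm (D \<kappa> (D \<nu> (D \<mu> f)) q)"] tendsto_norm)
      (auto simp: tendsto_at_iff_tendsto_nhds)
  then have "\<forall>\<^sub>F x in nhds q. \<forall>\<mu>\<in>I. \<forall>\<nu>\<in>I. \<forall>\<kappa>\<in>I. norm (D \<kappa> (D \<nu> (D \<mu> f)) x) < B \<mu> \<nu> \<kappa>"
    using \<open>finite I\<close> by (simp add: eventually_ball_finite_distrib)
  moreover have "\<forall>\<^sub>F x in nhds q. x \<in> S"
    using assms by (simp add: eventually_nhds_in_open)
  ultimately have "\<forall>\<^sub>F x in nhds q. x \<in> S \<and>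
      (\<forall>\<mu>\<in>I. \<forall>\<nu>\<in>I. \<forall>\<kappa>\<in>I. norm (D \<kappa> (D \<nu> (D \<mu> f)) x) < B \<mu> \<nu> \<kappa>)"
    by eventually_elim auto
  then obtain r where "0 < r" and rS: "\<And>x. dist x q < r \<Longrightarrow> x \<in> S"
    and rB: "\<And>x \<mu> \<nu> \<kappa>. dist x q < r \<Longrightarrow> \<mu> \<in> I \<Longrightarrow> \<nu> \<in> I \<Longrightarrow> \<kappa> \<in> I \<Longrightarrow>
      norm (D \<kappa> (D \<nu> (D \<mu> f)) x) < B \<mu> \<nu> \<kappa>"
    unfolding eventually_nhds_metric by blast
  have bound: "norm (f (q + h) - f q
        - ((\<Sum>\<mu>\<in>I. a \<mu> h * D \<mu> f q)
           + (1/2) *\<^sub>R (\<Sum>\<mu>\<in>I. \<Sum>\<nu>\<in>I. a \<mu> h * a \<nu> h * D \<nu> (D \<mu> f) q))) \<le> K * norm h ^ 3"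
    if "norm h < r" for h
  proof -
    let ?p = "\<lambda>t::real. q + t *\<^sub>R h"
    have p: "dist (?p t) q < r" if "t \<in> {0..1}" for t
    proof -
      have "\<bar>t\<bar> * norm h \<le> 1 * norm h" using that by (intro mult_right_mono) auto
      with \<open>norm h < r\<close> show ?thesis by (simp add: dist_norm)
    qed
    have line: "((\<lambda>t. F (?p t)) has_vector_derivative L h) (at t within {0..1})"
      if "(F has_derivative L) (at (?p t))" for F :: "'a \<Rightarrow> 'b" and L t
    proof -
      have "((\<lambda>t. F (?p t)) has_derivative (\<lambda>v. L (v *\<^sub>R h))) (at t)"
        by (rule has_derivative_compose[where f = ?p and g = F and g' = L, OF _ that]) (auto intro!: derivative_eq_intros)
      moreover have "L (v *\<^sub>R h) = v *\<^sub>R L h" for v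
        using has_derivative_bounded_linear[OF that] by (simp add: linear_simps)
      ultimately show ?thesis
        by (simp add: has_vector_derivative_def has_derivative_at_withinI)
    qed
    \<comment> \<open>\<open>g n\<close> for \<open>n \<le> 3\<close> is the \<open>n\<close>-th derivative of \<open>f\<close> along the segment.\<close>
    define g1 where "g1 t = (\<Sum>\<mu>\<in>I. a \<mu> h * D \<mu> f (?p t))" for t
    define g2 where "g2 t = (\<Sum>\<mu>\<in>I. a \<mu> h * (\<Sum>\<nu>\<in>I. a \<nu> h * D \<nu> (D \<mu> f) (?p t)))" for t
    define g3 where "g3 t = (\<Sum>\<mu>\<in>I. a \<mu> h * (\<Sum>\<nu>\<in>I. a \<nu> h *
      (\<Sum>\<kappa>\<in>I. a \<kappa> h * D \<kappa> (D \<nu> (D \<mu> f)) (?p t))))" for t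
    define g where "g n = [\<lambda>t. f (?p t), g1, g2, g3] ! n" for n :: nat
    have g: "(g n has_vector_derivative g (Suc n) t) (at t within {0..1})"
      if "n < 3" "0 \<le> t" "t \<le> 1" for n t
    proof -
      have S: "?p t \<in> S" using p rS that by simp
      have "((\<lambda>t. f (?p t)) has_vector_derivative g1 t) (at t within {0..1})"
        unfolding g1_def by (rule line[OF der1[OF S]])
      moreover have "(g1 has_vector_derivative g2 t) (at t within {0..1})"
        unfolding g1_def g2_def
        by (intro has_vector_derivative_sum has_vector_derivative_mult_right line[OF der2[OF _ S]])
      moreover have "(g2 has_vector_derivative g3 t) (at t within {0..1})"
        unfolding g2_def g3_def
        by (intro has_vector_derivative_sum has_vector_derivative_mult_right line[OF der3[OF _ _ S]])
      ultimately show ?thesis using \<open>n < 3\<close>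
        by (auto simp: g_def numeral_3_eq_3 less_Suc_eq)
    qed
    have g3: "norm (g3 t) \<le> K * norm h ^ 3" if "t \<in> {0..1}" for t
    proof -
      have "norm (g3 t) \<le> (\<Sum>\<mu>\<in>I. norm h * (\<Sum>\<nu>\<in>I. norm h * (\<Sum>\<kappa>\<in>I. norm h * B \<mu> \<nu> \<kappa>)))"
        unfolding g3_def using rB[OF p[OF that]]
        by (intro sum_norm_le order_trans[OF norm_mult_ineq] mult_mono a)
          (auto intro: less_imp_le)
      also have "\<dots> = K * norm h ^ 3"
        by (simp add: K_def sum_distrib_left sum_distrib_right power3_eq_cube mult_ac)
      finally show ?thesis .
    qed
    have "((\<lambda>x. ((1 - x) ^ (3 - 1) / fact (3 - 1)) *\<^sub>R g 3 x) has_integral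
        g 0 1 - (\<Sum>i<3. ((1 - 0) ^ i / fact i) *\<^sub>R g i 0)) {0..1}"
      by (rule Taylor_has_integral[of 3 g "g 0"]) (use g in auto)
    moreover have "norm (((1 - x) ^ (3 - 1) / fact (3 - 1)) *\<^sub>R g 3 x) \<le> K * norm h ^ 3"
      if x: "x \<in> {0..1}" for x
    proof -
      have "(1 - x) * (1 - x) \<le> 1" using x by (simp add: mult_le_one)
      then have "norm (((1 - x) ^ (3 - 1) / fact (3 - 1)) *\<^sub>R g 3 x) \<le> 1 * norm (g3 x)"
        unfolding norm_scaleR by (intro mult_mono) (auto simp: g_def numeral_3_eq_3 power2_eq_square)
      with g3[OF x] show ?thesis by simp
    qed
    moreover have "0 \<le> K * norm h ^ 3" using order_trans[OF norm_ge_zero g3[of 0]] by simp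
    ultimately have "norm (g 0 1 - (\<Sum>i<3. ((1 - 0) ^ i / fact i) *\<^sub>R g i 0))
        \<le> (K * norm h ^ 3) * measure lborel (cbox 0 (1::real))"
      by (intro has_integral_bound) auto
    then show ?thesis
      by (simp add: g_def g1_def g2_def numeral_3_eq_3 sum_distrib_left mult.assoc algebra_simps)
  qed
  have "\<forall>\<^sub>F h in at (0::'a). norm h < r"
    unfolding eventually_at using \<open>0 < r\<close> by (auto simp: dist_norm)
  then show ?thesis
    by (intro bigoI[of _ K]) (auto elim!: eventually_mono intro: bound)
qed

section \<open>Right HR derivatives and the derivative\<close>

lemma sum_quat_units: "sum g quat_units = g 1 + g \<i>\<^sub>q + g \<j>\<^sub>q + g \<k>\<^sub>q" for g :: "quat \<Rightarrow> 'a::comm_monoid_add"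
  by (simp add: quat_units_def quat_eq_iff quat_i_def quat_j_def quat_k_def add.assoc)

lemma Basis_quat_units: "(Basis :: quat set) = quat_units"
  by (simp add: Basis_quat_def quat_units_def)

lemma norm_quat_units: "\<mu> \<in> quat_units \<Longrightarrow> norm \<mu> = 1"
  using norm_Basis by (simp add: Basis_quat_units)

lemma norm_qcnj [simp]: "norm (qcnj h) = norm h"
  by (simp add: norm_quat_def)

lemma norm_qrot: "\<mu> \<in> quat_units \<Longrightarrow> norm (qrot \<mu> h) = norm h"
  by (simp add: qrot_def norm_mult norm_inverse norm_quat_units)

lemma qrot_mult:
  assumes "\<mu> \<in> quat_units"
  shows "qrot \<mu> p * qrot \<mu> q = qrot \<mu> (p * q)"
proof -
  have "\<mu> \<noteq> 0" using norm_quat_units[OF assms] by auto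
  then have "inverse \<mu> * (\<mu> * r) = r" for r by (simp flip: mult.assoc)
  then show ?thesis by (simp add: qrot_def mult.assoc)
qed

lemma qrot_quat_units:
  "qrot 1 p = p"
  "qrot \<i>\<^sub>q p = Quat (qa p) (qb p) (- qc p) (- qd p)"
  "qrot \<j>\<^sub>q p = Quat (qa p) (- qb p) (qc p) (- qd p)"
  "qrot \<k>\<^sub>q p = Quat (qa p) (- qb p) (- qc p) (qd p)"
  by (simp_all add: quat_eq_iff qrot_def inverse_quat_def norm_quat_sq
      quat_i_def quat_j_def quat_k_def)

lemma qcnj_qrot: "\<mu> \<in> quat_units \<Longrightarrow> qcnj (qrot \<mu> p) = qrot \<mu> (qcnj p)"
  unfolding quat_units_def
  by (elim insertE emptyE; simp add: qrot_quat_units; simp add: quat_eq_iff)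

text \<open>
  The nontrivial rotations each flip two of the three imaginary coordinates, and every imaginary
  coordinate is flipped by exactly two of them.
\<close>
lemma sum_qrot: "(\<Sum>\<mu>\<in>quat_units. qrot \<mu> p) = of_real (4 * qa p)"
  by (simp add: sum_quat_units qrot_quat_units quat_eq_iff of_real_def)

lemma sum_qrot_mult: "(\<Sum>\<mu>\<in>quat_units. qrot \<mu> p * c) = (4 * qa p) *\<^sub>R c"
  by (simp only: sum_qrot flip: sum_distrib_right) (simp add: scaleR_conv_of_real)

text \<open>
  Multiplicativity of the rotations moves the unit next to \<open>h\<close>, after which the sum over \<open>\<mu>\<close> leaves
  only the real part: \<open>Re (h i) = - h\<^sub>b\<close>, and similarly for \<open>j\<close> and \<open>k\<close>.
\<close>
lemma sum_qrot_hr_deriv: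
  "(\<Sum>\<mu>\<in>quat_units. qrot \<mu> h * hr_deriv \<mu> f x) = (\<Sum>e\<in>Basis. (h \<bullet> e) *\<^sub>R qpartial e f x)"
proof -
  have "(\<Sum>\<mu>\<in>quat_units. qrot \<mu> h * hr_deriv \<mu> f x) = (\<Sum>\<mu>\<in>quat_units. (1/4) *\<^sub>R
      (qrot \<mu> h * qpartial 1 f x - qrot \<mu> (h * \<i>\<^sub>q) * qpartial \<i>\<^sub>q f x
        - qrot \<mu> (h * \<j>\<^sub>q) * qpartial \<j>\<^sub>q f x - qrot \<mu> (h * \<k>\<^sub>q) * qpartial \<k>\<^sub>q f x))"
    by (intro sum.cong) (simp_all add: hr_deriv_def right_diff_distrib qrot_mult flip: mult.assoc)
  also have "\<dots> = (1/4) *\<^sub>R ((4 * qa h) *\<^sub>R qpartial 1 f x - (4 * qa (h * \<i>\<^sub>q)) *\<^sub>R qpartial \<i>\<^sub>q f x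
      - (4 * qa (h * \<j>\<^sub>q)) *\<^sub>R qpartial \<j>\<^sub>q f x - (4 * qa (h * \<k>\<^sub>q)) *\<^sub>R qpartial \<k>\<^sub>q f x)"
    by (simp only: sum_subtractf sum_qrot_mult flip: scaleR_sum_right)
  also have "\<dots> = (\<Sum>e\<in>Basis. (h \<bullet> e) *\<^sub>R qpartial e f x)"
    by (simp add: Basis_quat_units sum_quat_units inner_quat_def algebra_simps
        quat_i_def quat_j_def quat_k_def)
  finally show ?thesis .
qed

text \<open>
  The signs in the conjugated derivative are opposite, and so is \<open>Re (h\<^sup>* i) = h\<^sub>b\<close>; the two
  changes cancel.
\<close>
lemma sum_qrot_hr_conj_deriv:
  "(\<Sum>\<mu>\<in>quat_units. qcnj (qrot \<mu> h) * hr_conj_deriv \<mu> f x) = (\<Sum>e\<in>Basis. (h \<bullet> e) *\<^sub>R qpartial e f x)"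
proof -
  have "(\<Sum>\<mu>\<in>quat_units. qcnj (qrot \<mu> h) * hr_conj_deriv \<mu> f x) = (\<Sum>\<mu>\<in>quat_units. (1/4) *\<^sub>R
      (qrot \<mu> (qcnj h) * qpartial 1 f x + qrot \<mu> (qcnj h * \<i>\<^sub>q) * qpartial \<i>\<^sub>q f x
        + qrot \<mu> (qcnj h * \<j>\<^sub>q) * qpartial \<j>\<^sub>q f x + qrot \<mu> (qcnj h * \<k>\<^sub>q) * qpartial \<k>\<^sub>q f x))"
    by (intro sum.cong)
      (simp_all add: hr_conj_deriv_def distrib_left qcnj_qrot qrot_mult flip: mult.assoc)
  also have "\<dots> = (1/4) *\<^sub>R ((4 * qa (qcnj h)) *\<^sub>R qpartial 1 f x
      + (4 * qa (qcnj h * \<i>\<^sub>q)) *\<^sub>R qpartial \<i>\<^sub>q f x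
      + (4 * qa (qcnj h * \<j>\<^sub>q)) *\<^sub>R qpartial \<j>\<^sub>q f x + (4 * qa (qcnj h * \<k>\<^sub>q)) *\<^sub>R qpartial \<k>\<^sub>q f x)"
    by (simp only: sum.distrib sum_qrot_mult flip: scaleR_sum_right)
  also have "\<dots> = (\<Sum>e\<in>Basis. (h \<bullet> e) *\<^sub>R qpartial e f x)"
    by (simp add: Basis_quat_units sum_quat_units inner_quat_def algebra_simps
        quat_i_def quat_j_def quat_k_def)
  finally show ?thesis .
qed

text \<open>
  The special case \<open>h = e\<close> inverts the definition of the HR derivatives.  It transfers continuity
  from them to the partial derivatives.
\<close>
lemma qpartial_eq_sum_hr_deriv:
  assumes "e \<in> Basis"
  shows "qpartial e f x = (\<Sum>\<mu>\<in>quat_units. qrot \<mu> e * hr_deriv \<mu> f x)"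
  using assms by (simp add: sum_qrot_hr_deriv inner_Basis if_distrib[of "\<lambda>c. c *\<^sub>R _"] cong: if_cong)

lemma has_derivative_qpartials:
  assumes "open S" "hr_derivs_continuous_on (Suc n) S f" "x \<in> S"
  shows "(f has_derivative (\<lambda>h. \<Sum>e\<in>Basis. (h \<bullet> e) *\<^sub>R qpartial e f x)) (at x)"
proof (rule has_derivative_continuous_partials[OF assms(1,3)])
  fix y e :: quat
  assume "y \<in> S" "e \<in> Basis"
  then show "((\<lambda>t. f (y + t *\<^sub>R e)) has_vector_derivative qpartial e f y) (at 0)"
    using assms(2) by (auto simp: qpartial_def qpartials_exist_at_def Basis_quat_def
        vector_derivative_works[symmetric])
next
  fix e :: quat
  assume "e \<in> Basis"
  have "continuous_on S (\<lambda>x. \<Sum>\<mu>\<in>quat_units. qrot \<mu> e * hr_deriv \<mu> f x)"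
    using assms(2) by (intro continuous_intros) auto
  moreover have "qpartial e f = (\<lambda>x. \<Sum>\<mu>\<in>quat_units. qrot \<mu> e * hr_deriv \<mu> f x)"
    using \<open>e \<in> Basis\<close> by (intro ext qpartial_eq_sum_hr_deriv)
  ultimately show "isCont (qpartial e f) x"
    using assms(1,3) by (simp add: continuous_on_eq_continuous_at)
qed

lemma has_derivative_hr_deriv:
  assumes "open S" "hr_derivs_continuous_on (Suc n) S f" "x \<in> S"
  shows "(f has_derivative (\<lambda>h. \<Sum>\<mu>\<in>quat_units. qrot \<mu> h * hr_deriv \<mu> f x)) (at x)"
  using has_derivative_qpartials[OF assms] by (simp add: sum_qrot_hr_deriv)

lemma has_derivative_hr_conj_deriv:
  assumes "open S" "hr_derivs_continuous_on (Suc n) S f" "x \<in> S"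
  shows "(f has_derivative (\<lambda>h. \<Sum>\<mu>\<in>quat_units. qcnj (qrot \<mu> h) * hr_conj_deriv \<mu> f x)) (at x)"
  using has_derivative_qpartials[OF assms] by (simp add: sum_qrot_hr_conj_deriv)

section \<open>The second-order expansion\<close>

theorem theorem3p23:
  fixes f :: "quat \<Rightarrow> quat" and S :: "quat set" and q\<^sub>0 :: quat
  assumes "open S"
    and "continuous_on S f"
    and "hr_derivs_continuous_on 3 S f"
    and "q\<^sub>0 \<in> S"
  shows
    "(\<lambda>h. norm (f (q\<^sub>0 + h) - f q\<^sub>0
        - ((\<Sum>\<mu>\<in>quat_units. qrot \<mu> h * hr_deriv \<mu> f q\<^sub>0)
           + (1/2) *\<^sub>R (\<Sum>\<mu>\<in>quat_units. \<Sum>\<nu>\<in>quat_units.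
               qrot \<mu> h * qrot \<nu> h * hr_deriv \<nu> (hr_deriv \<mu> f) q\<^sub>0))))
      \<in> O[at 0 within {h. closed_segment q\<^sub>0 (q\<^sub>0 + h) \<subseteq> S}](\<lambda>h. norm h ^ 3) \<and>
     (\<lambda>h. norm (f (q\<^sub>0 + h) - f q\<^sub>0
        - ((\<Sum>\<mu>\<in>quat_units. qcnj (qrot \<mu> h) * hr_conj_deriv \<mu> f q\<^sub>0)
           + (1/2) *\<^sub>R (\<Sum>\<mu>\<in>quat_units. \<Sum>\<nu>\<in>quat_units.
               qcnj (qrot \<mu> h) * qcnj (qrot \<nu> h) * hr_conj_deriv \<nu> (hr_conj_deriv \<mu> f) q\<^sub>0))))
      \<in> O[at 0 within {h. closed_segment q\<^sub>0 (q\<^sub>0 + h) \<subseteq> S}](\<lambda>h. norm h ^ 3)"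
proof -
  have reg: "hr_derivs_continuous_on (Suc (Suc (Suc 0))) S f"
    using assms(3) by (simp add: numeral_3_eq_3)
  have fin: "finite quat_units" by (simp add: quat_units_def)
  have le: "at 0 within {h. closed_segment q\<^sub>0 (q\<^sub>0 + h) \<subseteq> S} \<le> at 0"
    by (rule at_le) simp
  have "(\<lambda>h. norm (f (q\<^sub>0 + h) - f q\<^sub>0
        - ((\<Sum>\<mu>\<in>quat_units. qrot \<mu> h * hr_deriv \<mu> f q\<^sub>0)
           + (1/2) *\<^sub>R (\<Sum>\<mu>\<in>quat_units. \<Sum>\<nu>\<in>quat_units.
               qrot \<mu> h * qrot \<nu> h * hr_deriv \<nu> (hr_deriv \<mu> f) q\<^sub>0))))
      \<in> O[at 0](\<lambda>h. norm h ^ 3)"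
  proof (rule taylor2_derivative_operators[OF \<open>open S\<close> \<open>q\<^sub>0 \<in> S\<close> fin])
    show "norm (qrot \<mu> h) \<le> norm h" if "\<mu> \<in> quat_units" for \<mu> h
      using that by (simp add: norm_qrot)
    show "isCont (hr_deriv \<kappa> (hr_deriv \<nu> (hr_deriv \<mu> f))) q\<^sub>0"
      if "\<mu> \<in> quat_units" "\<nu> \<in> quat_units" "\<kappa> \<in> quat_units" for \<mu> \<nu> \<kappa>
      using reg that \<open>open S\<close> \<open>q\<^sub>0 \<in> S\<close> by (simp add: continuous_on_eq_continuous_at)
  qed (use reg in \<open>auto intro: has_derivative_hr_deriv[OF \<open>open S\<close>, of "Suc (Suc 0)"]
      has_derivative_hr_deriv[OF \<open>open S\<close>, of "Suc 0"] has_derivative_hr_deriv[OF \<open>open S\<close>, of 0]\<close>)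
  moreover have "(\<lambda>h. norm (f (q\<^sub>0 + h) - f q\<^sub>0
        - ((\<Sum>\<mu>\<in>quat_units. qcnj (qrot \<mu> h) * hr_conj_deriv \<mu> f q\<^sub>0)
           + (1/2) *\<^sub>R (\<Sum>\<mu>\<in>quat_units. \<Sum>\<nu>\<in>quat_units.
               qcnj (qrot \<mu> h) * qcnj (qrot \<nu> h) * hr_conj_deriv \<nu> (hr_conj_deriv \<mu> f) q\<^sub>0))))
      \<in> O[at 0](\<lambda>h. norm h ^ 3)"
  proof (rule taylor2_derivative_operators[OF \<open>open S\<close> \<open>q\<^sub>0 \<in> S\<close> fin])
    show "norm (qcnj (qrot \<mu> h)) \<le> norm h" if "\<mu> \<in> quat_units" for \<mu> h
      using that by (simp add: norm_qrot)
    show "isCont (hr_conj_deriv \<kappa> (hr_conj_deriv \<nu> (hr_conj_deriv \<mu> f))) q\<^sub>0"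
      if "\<mu> \<in> quat_units" "\<nu> \<in> quat_units" "\<kappa> \<in> quat_units" for \<mu> \<nu> \<kappa>
      using reg that \<open>open S\<close> \<open>q\<^sub>0 \<in> S\<close> by (simp add: continuous_on_eq_continuous_at)
  qed (use reg in \<open>auto intro: has_derivative_hr_conj_deriv[OF \<open>open S\<close>, of "Suc (Suc 0)"]
      has_derivative_hr_conj_deriv[OF \<open>open S\<close>, of "Suc 0"] has_derivative_hr_conj_deriv[OF \<open>open S\<close>, of 0]\<close>)
  ultimately show ?thesis
    using landau_o.big.filter_mono[OF le] by blast
qed

end
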